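(* For any probability measure $\mu_0$ on $S$ and any $t\ge 0$, $$\frac{\varphi_\wedge}{2\varphi_\vee}\,\bigl\|\tilde\mu_0\tilde P_t-\tilde\eta\bigr\|_{\mathrm{tv}}\ \le\ \|\mu_t-\nu\|_{\mathrm{tv}}\ \le\ 2\,\frac{\varphi_\vee}{\varphi_\wedge}\,\bigl\|\tilde\mu_0\tilde P_t-\tilde\eta\bigr\|_{\mathrm{tv}},$$ where $\tilde\mu_0$ is the probability measure on $S$ whose density with respect to $\mu_0$ is proportional to $\varphi$. In particular, the asymptotic exponential rates of convergence to $0$ (as $t\to+\infty$) of $\|\mu_t-\nu\|_{\mathrm{tv}}$ and of $\|\tilde\mu_0\tilde P_t-\tilde\eta\|_{\mathrm{tv}}$ are the same.
   Context: Let $S$ be a finite set, $\bar S=S\sqcup\{\infty\}$, and let $\bar L=(\bar L(x,y))_{x,y\in\bar S}$ be a Markov generator on $\bar S$ (nonnegative off-diagonal entries, zero row sums) for which $\infty$ is absorbing. Put $V(x)=\bar L(x,\infty)\ge 0$ for $x\in S$; $V$ also denotes the diagonal matrix (multiplication operator). Let $L$ be the Markov generator on $S$ such that the $S\times S$ block of $\bar L$ is $L-V$. Standing assumption: $L$ is irreducible. Measures are row vectors, functions are column vectors, and $m[f]=\sum_x m(x)f(x)$. For a probability measure $\mu_0$ on $S$ and $t\ge0$, $\mu_t$ is the probability measure on $S$ given by $\mu_t[f]=\dfrac{\mu_0\,[e^{t(L-V)}f]}{\mu_0\,[e^{t(L-V)}\mathbf 1_S]}$ for $f:S\to\mathbb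 R$ (the law at time $t$ of the process with generator $\bar L$ started from $\mu_0$, conditioned on not being absorbed by time $t$). The quasi-stationary measure $\nu$ is the unique probability measure on $S$ such that $\mu_0=\nu$ implies $\mu_t=\nu$ for all $t\geq 0$. By Perron–Frobenius there is $\lambda_1\ge 0$, the eigenvalue of $V-L$ strictly less than the real parts of all its other (complex) eigenvalues, with $\nu(L-V)=-\lambda_1\nu$. Let $\eta$ be the unique invariant probability measure of $L$ (it charges every point), and let $L^*(x,y)=\frac{\eta(y)}{\eta(x)}L(y,x)$ be the adjoint of $L$ in $\mathbb L^2(\eta)$. Let $\varphi>0$ on $S$ satisfy $(L-V)\varphi=-\lambda_1\varphi$, normalized by $\eta[\varphi^2]=1$, and let $\varphi^*>0$ on $S$ satisfy $(L^*-V)\varphi^*=-\lambda_1\varphi^*$, normalized by $\eta[\varphi^*]=1$. For a positive function $f$ on $S$, $f_\wedge=\min_S f$ and $f_\vee=\max_S f$. $\tilde L$ is the Markov generator on $S$ with off-diagonal entries $\tilde L(x,y)=L(x,y)\frac{\varphi(y)}{\varphi(x)}$ for $x\ne y$ (diagonal entries determined by zero row sums), $\tilde P_t=e^{t\tilde L}$, and $\tilde\eta$ is its invariant probability measure, given by $\tilde\eta(x)=\frac{\varphi(x)\varphi^*(x)\eta(x)}{\sum_{y\in S}\varphi(y)\varphi^*(y)\eta(y)}$. For a signed measure $m$ on $S$ with $m(S)=0$, $\|m\|_{\mathrm{tv}}=\sum_{x\in S}|m(x)|$. Two nonnegative functions $a(t),b(t)$ have the same asymptotic exponential rate if $\frac1t\ln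 a(t)$ and $\frac1t\ln b(t)$ have the same asymptotic behaviour: one converges (in $[-\infty,\infty)$, with $\ln 0=-\infty$) as $t\to+\infty$ iff the other does, and then to the same limit. *)

theory Defs
  imports "HOL-Analysis.Analysis"
begin

text \<open>
  The finite state space is a type \<open>'n\<close> of class \<open>finite\<close>. The state space extended by the cemetery
  point is \<open>'n option\<close>, with \<open>None\<close> as cemetery. Measures and functions are both vectors
  \<open>real ^ 'n\<close>; a measure \<open>m\<close> acts on a function \<open>f\<close> by \<open>m \<bullet> f\<close>, and
  matrices act on measures by \<open>v*\<close> and on functions by \<open>*v\<close>.
\<close>

definition prob_vec :: "real ^ 'n::finite \<Rightarrow> bool" where
  "prob_vec m \<longleftrightarrow> (\<forall>x. 0 \<le> m $ x) \<and> (\<Sum>x\<in>UNIV. m $ x) = 1"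

definition tv_norm :: "real ^ 'n::finite \<Rightarrow> real" where
  "tv_norm m = (\<Sum>x\<in>UNIV. \<bar>m $ x\<bar>)"

definition diag_matrix :: "real ^ 'n::finite \<Rightarrow> real ^ 'n ^ 'n" where
  "diag_matrix v = (\<chi> x y. if x = y then v $ x else 0)"

text \<open>
  The product \<open>*\<close> on \<open>real ^ 'n ^ 'n\<close> is componentwise, so the library's \<open>power\<close> and \<open>exp\<close> do not
  give matrix powers and the matrix exponential.
\<close>

primrec matrix_pow :: "real ^ 'n::finite ^ 'n \<Rightarrow> nat \<Rightarrow> real ^ 'n ^ 'n" where
  "matrix_pow A 0 = mat 1"
| "matrix_pow A (Suc k) = A ** matrix_pow A k"

definition matrix_exp :: "real ^ 'n::finite ^ 'n \<Rightarrow> real ^ 'n ^ 'n" where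
  "matrix_exp A = (\<Sum>k. (1 / fact k) *\<^sub>R matrix_pow A k)"

lemma matrix_exp_sums:
  fixes A :: "real ^ 'n::finite ^ 'n"
  shows "(\<lambda>k. (1 / fact k) *\<^sub>R matrix_pow A k) sums matrix_exp A"
proof -
  have "bilinear ((**) :: real ^ 'n ^ 'n \<Rightarrow> real ^ 'n ^ 'n \<Rightarrow> real ^ 'n ^ 'n)"
    by (auto simp: bilinear_def matrix_matrix_mult_def vec_eq_iff sum.distrib sum_distrib_left
        algebra_simps intro!: linearI)
  then have "bounded_bilinear ((**) :: real ^ 'n ^ 'n \<Rightarrow> real ^ 'n ^ 'n \<Rightarrow> real ^ 'n ^ 'n)"
    by (simp add: bilinear_conv_bounded_bilinear)
  then obtain K where K: "0 < K" "\<And>(B :: real ^ 'n ^ 'n) (C :: real ^ 'n ^ 'n). norm (B ** C) \<le> norm B * norm C * K"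
    using bounded_bilinear.pos_bounded by blast
  have bound: "norm (matrix_pow A k) \<le> norm (mat 1 :: real ^ 'n ^ 'n) * (norm A * K) ^ k" for k
  proof (induction k)
    case (Suc k)
    have "norm (matrix_pow A (Suc k)) \<le> norm A * norm (matrix_pow A k) * K"
      using K(2) by simp
    also have "\<dots> \<le> norm A * (norm (mat 1 :: real ^ 'n ^ 'n) * (norm A * K) ^ k) * K"
      using Suc K(1) by (intro mult_right_mono mult_left_mono) auto
    finally show ?case by (simp add: mult_ac)
  qed simp
  have "summable (\<lambda>k. norm (mat 1 :: real ^ 'n ^ 'n) * (inverse (fact k) * (norm A * K) ^ k))"
    by (intro summable_mult summable_exp)
  then have "summable (\<lambda>k. (1 / fact k) *\<^sub>R matrix_pow A k)"
  proof (rule summable_comparison_test')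
    fix k :: nat
    show "norm ((1 / fact k) *\<^sub>R matrix_pow A k)
        \<le> norm (mat 1 :: real ^ 'n ^ 'n) * (inverse (fact k) * (norm A * K) ^ k)"
      using mult_left_mono[OF bound[of k], of "inverse (fact k)"] by (simp add: field_simps)
  qed
  then show ?thesis
    unfolding matrix_exp_def by (rule summable_sums)
qed

definition markov_generator :: "real ^ 'n::finite ^ 'n \<Rightarrow> bool" where
  "markov_generator L \<longleftrightarrow>
     (\<forall>x y. x \<noteq> y \<longrightarrow> 0 \<le> L $ x $ y) \<and> (\<forall>x. (\<Sum>y\<in>UNIV. L $ x $ y) = 0)"

definition irreducible_generator :: "real ^ 'n::finite ^ 'n \<Rightarrow> bool" where
  "irreducible_generator L \<longleftrightarrow> (\<forall>x y. (x, y) \<in> {(u, v). 0 < L $ u $ v}\<^sup>*)"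

lemma markov_generator_decomposition:
  fixes Lbar :: "real ^ ('n::finite option) ^ ('n option)"
  assumes "markov_generator Lbar"
    and V: "V = (\<chi> x. Lbar $ Some x $ None)"
    and L: "(\<chi> x y. Lbar $ Some x $ Some y) = L - diag_matrix V"
  shows "markov_generator L"
proof -
  have Lxy: "L $ x $ y = Lbar $ Some x $ Some y + (if x = y then Lbar $ Some x $ None else 0)"
    for x y
    using arg_cong[OF L, of "\<lambda>M. M $ x $ y"] by (simp add: diag_matrix_def V split: if_splits)
  have "(\<Sum>y\<in>UNIV. Lbar $ Some x $ y) = Lbar $ Some x $ None + (\<Sum>y\<in>UNIV. Lbar $ Some x $ Some y)"
    for x
    by (simp add: UNIV_option_conv sum.reindex)
  then show ?thesis
    using assms(1) unfolding markov_generator_def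
    by (auto simp: Lxy sum.distrib add.commute)
qed

definition invariant_prob :: "real ^ 'n::finite ^ 'n \<Rightarrow> real ^ 'n \<Rightarrow> bool" where
  "invariant_prob L m \<longleftrightarrow> prob_vec m \<and> m v* L = 0"

definition complex_eigenvalue :: "real ^ 'n::finite ^ 'n \<Rightarrow> complex \<Rightarrow> bool" where
  "complex_eigenvalue A z \<longleftrightarrow>
     (\<exists>v :: complex ^ 'n. v \<noteq> 0 \<and> map_matrix complex_of_real A *v v = z *s v)"

definition principal_eigenvalue :: "real ^ 'n::finite ^ 'n \<Rightarrow> real \<Rightarrow> bool" where
  "principal_eigenvalue A l \<longleftrightarrow>
     complex_eigenvalue A (complex_of_real l) \<and>
     (\<forall>z. complex_eigenvalue A z \<and> z \<noteq> complex_of_real l \<longrightarrow> l < Re z)"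

definition cond_law ::
    "real ^ 'n::finite ^ 'n \<Rightarrow> real ^ 'n \<Rightarrow> real ^ 'n \<Rightarrow> real \<Rightarrow> real ^ 'n" where
  "cond_law L V mu0 t =
     (let E = matrix_exp (t *\<^sub>R (L - diag_matrix V))
      in (1 / (mu0 \<bullet> (E *v 1))) *\<^sub>R (mu0 v* E))"

lemma cond_law_inner:
  "cond_law L V mu0 t \<bullet> f =
     (mu0 \<bullet> (matrix_exp (t *\<^sub>R (L - diag_matrix V)) *v f)) /
     (mu0 \<bullet> (matrix_exp (t *\<^sub>R (L - diag_matrix V)) *v 1))"
  by (simp add: cond_law_def Let_def dot_lmul_matrix)

definition quasi_stationary :: "real ^ 'n::finite ^ 'n \<Rightarrow> real ^ 'n \<Rightarrow> real ^ 'n \<Rightarrow> bool" where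
  "quasi_stationary L V nu \<longleftrightarrow> prob_vec nu \<and> (\<forall>t\<ge>0. cond_law L V nu t = nu)"

definition adjoint_generator :: "real ^ 'n::finite \<Rightarrow> real ^ 'n ^ 'n \<Rightarrow> real ^ 'n ^ 'n" where
  "adjoint_generator eta L = (\<chi> x y. eta $ y / eta $ x * L $ y $ x)"

definition tilde_generator :: "real ^ 'n::finite ^ 'n \<Rightarrow> real ^ 'n \<Rightarrow> real ^ 'n ^ 'n" where
  "tilde_generator L phi =
     (\<chi> x y. if x \<noteq> y then L $ x $ y * (phi $ y / phi $ x)
            else - (\<Sum>z\<in>UNIV - {x}. L $ x $ z * (phi $ z / phi $ x)))"

definition reweight :: "real ^ 'n::finite \<Rightarrow> real ^ 'n \<Rightarrow> real ^ 'n" where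
  "reweight phi m = (\<chi> x. m $ x * phi $ x / (m \<bullet> phi))"

definition min_val :: "real ^ 'n::finite \<Rightarrow> real" where
  "min_val f = Min (range (\<lambda>x. f $ x))"

definition max_val :: "real ^ 'n::finite \<Rightarrow> real" where
  "max_val f = Max (range (\<lambda>x. f $ x))"

text \<open>The logarithm with \<open>ln 0 = -\<infinity>\<close>; only used for nonnegative arguments.\<close>

definition ext_ln :: "real \<Rightarrow> ereal" where
  "ext_ln r = (if r \<le> 0 then -\<infinity> else ereal (ln r))"

text \<open>
  Convergence in \<open>[-\<infinity>, \<infinity>)\<close> is convergence in \<open>ereal\<close> to a limit other than \<open>\<infinity>\<close>. That one
  function converges iff the other does, and to the same limit, means that both have the same limits
  in this range.
\<close>

definition same_exp_rate :: "(real \<Rightarrow> real) \<Rightarrow> (real \<Rightarrow> real) \<Rightarrow> bool" where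
  "same_exp_rate a b \<longleftrightarrow>
     (\<forall>l::ereal. l < \<infinity> \<longrightarrow>
        (((\<lambda>t. ereal (1 / t) * ext_ln (a t)) \<longlongrightarrow> l) at_top \<longleftrightarrow>
         ((\<lambda>t. ereal (1 / t) * ext_ln (b t)) \<longlongrightarrow> l) at_top))"

end

theory Submission
  imports Defs
begin

text \<open>
  Let \<open>D\<close> be the diagonal matrix of \<open>\<phi>\<close> and \<open>G\<close> the tilted generator. Doob's transform reads
  \<open>L - V = D (G - \<lambda>\<^sub>1) D\<^sup>-\<^sup>1\<close>. With \<open>m\<close> the reweighting of \<open>\<mu>\<^sub>0\<close> by \<open>\<phi>\<close>, the conditional law
  \<open>\<mu>\<^sub>t\<close> is therefore the probability \<open>p\<^sub>t = m exp (t G)\<close> reweighted by \<open>1 / \<phi>\<close>, and \<open>p\<^sub>t\<close> is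
  \<open>\<mu>\<^sub>t\<close> reweighted by \<open>\<phi>\<close>. In particular the reweighting of \<open>\<nu>\<close> by \<open>\<phi>\<close> is invariant for \<open>G\<close>,
  hence equal to its unique invariant probability. Reweighting by a function with values in
  \<open>[a, b]\<close> is Lipschitz with constant \<open>2 b / a\<close> in total variation, which gives both inequalities.
\<close>

subsection \<open>The matrix exponential\<close>

lemma matrix_exp_nth_sums:
  fixes A :: "real ^ 'n::finite ^ 'n"
  shows "(\<lambda>k. matrix_pow A k $ x $ y / fact k) sums (matrix_exp A $ x $ y)"
proof -
  have "bounded_linear (\<lambda>M :: real ^ 'n ^ 'n. M $ x $ y)"
    by (intro bounded_linear_compose[OF bounded_linear_vec_nth bounded_linear_vec_nth])
  from bounded_linear.sums[OF this matrix_exp_sums[of A]] show ?thesis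
    by simp
qed

lemma vector_matrix_exp_nth_sums:
  "(\<lambda>k. (m v* matrix_pow A k) $ y / fact k) sums ((m v* matrix_exp A) $ y)"
proof -
  have "(\<lambda>k. \<Sum>x\<in>UNIV. matrix_pow A k $ x $ y / fact k * m $ x)
      sums (\<Sum>x\<in>UNIV. matrix_exp A $ x $ y * m $ x)"
    by (intro sums_sum sums_mult2 matrix_exp_nth_sums)
  then show ?thesis
    by (simp add: vector_matrix_mult_def sum_divide_distrib mult.commute)
qed

text \<open>Entries of powers of \<open>A\<close> are dominated by those of powers of the entrywise
  absolute value \<open>B\<close>, whose exponential series converges. Absolute convergence is what
  the Cauchy product in \<open>matrix_exp_add_mat\<close> requires.\<close>

lemma matrix_exp_summable_abs:
  "summable (\<lambda>k. \<bar>matrix_pow A k $ x $ y / fact k\<bar>)"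
proof -
  define B where "B = (\<chi> x y. \<bar>A $ x $ y\<bar>)"
  have "\<bar>matrix_pow A k $ x $ y\<bar> \<le> matrix_pow B k $ x $ y" for k x y
  proof (induction k arbitrary: x)
    case (Suc k)
    show ?case
      unfolding matrix_pow.simps matrix_matrix_mult_def
      by (auto simp: B_def abs_mult intro!: order_trans[OF sum_abs] sum_mono mult_left_mono
          Suc.IH[unfolded B_def])
  qed (simp add: mat_def)
  then show ?thesis
    by (intro summable_comparison_test'[OF sums_summable[OF matrix_exp_nth_sums[of B x y]]])
      (simp add: divide_right_mono)
qed

lemma matrix_pow_scaleR: "matrix_pow (t *\<^sub>R A) k = t ^ k *\<^sub>R matrix_pow A k"
proof (induction k)
  case (Suc k)
  then show ?case
    by (simp add: matrix_matrix_mult_def vec_eq_iff sum_distrib_left mult_ac)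
qed simp

section \<open>Diagonal conjugation and scalar shifts in the exponential\<close>

lemma matrix_pow_similar:
  fixes A B :: "real ^ 'n::finite ^ 'n"
  assumes d: "\<And>x. d x \<noteq> 0" and A: "\<And>x y. A $ x $ y = d x * B $ x $ y / d y"
  shows "matrix_pow A k $ x $ y = d x * matrix_pow B k $ x $ y / d y"
proof (induction k arbitrary: x)
  case 0
  then show ?case using d by (simp add: mat_def)
next
  case (Suc k)
  have "matrix_pow A (Suc k) $ x $ y
      = (\<Sum>z\<in>UNIV. d x * B $ x $ z / d z * (d z * matrix_pow B k $ z $ y / d y))"
    by (simp only: matrix_pow.simps matrix_matrix_mult_def vec_lambda_beta A Suc)
  also have "\<dots> = (\<Sum>z\<in>UNIV. d x * (B $ x $ z * matrix_pow B k $ z $ y) / d y)"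
    using d by (intro sum.cong) auto
  also have "\<dots> = d x * matrix_pow B (Suc k) $ x $ y / d y"
    by (simp add: matrix_matrix_mult_def sum_distrib_left sum_divide_distrib)
  finally show ?case .
qed

lemma matrix_exp_similar:
  fixes A B :: "real ^ 'n::finite ^ 'n"
  assumes "\<And>x. d x \<noteq> 0" and "\<And>x y. A $ x $ y = d x * B $ x $ y / d y"
  shows "matrix_exp A $ x $ y = d x * matrix_exp B $ x $ y / d y"
proof -
  have "(\<lambda>k. d x / d y * (matrix_pow B k $ x $ y / fact k)) sums
      (d x / d y * matrix_exp B $ x $ y)"
    by (intro sums_mult matrix_exp_nth_sums)
  moreover have "(\<lambda>k. d x / d y * (matrix_pow B k $ x $ y / fact k))
      = (\<lambda>k. matrix_pow A k $ x $ y / fact k)"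
    using matrix_pow_similar[OF assms] by (simp add: fun_eq_iff)
  ultimately show ?thesis
    using matrix_exp_nth_sums[of A x y] by (auto dest: sums_unique2)
qed

text \<open>Binomial theorem for the commuting pair \<open>A\<close>, \<open>mat c\<close>. Dividing
  by \<open>fact k\<close> turns the right side into the Cauchy product of the two exponential
  series.\<close>

lemma matrix_pow_add_mat:
  fixes A :: "real ^ 'n::finite ^ 'n"
  shows "matrix_pow (A + mat c) k $ x $ y / fact k
    = (\<Sum>i\<le>k. (matrix_pow A i $ x $ y / fact i) * (c ^ (k - i) / fact (k - i)))"
proof (induction k arbitrary: x)
  case (Suc k)
  define a where "a i x = matrix_pow A i $ x $ y / fact i" for i x
  define g where "g i = c ^ i / fact i" for i
  have a_Suc: "(\<Sum>z\<in>UNIV. A $ x $ z * a i z) = real (Suc i) * a (Suc i) x" for i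
  proof -
    have "real (Suc i) * a (Suc i) x = matrix_pow A (Suc i) $ x $ y / fact i"
      unfolding a_def fact_Suc by (simp del: of_nat_Suc matrix_pow.simps)
    then show ?thesis
      by (simp add: a_def matrix_matrix_mult_def sum_divide_distrib)
  qed
  have g_Suc: "c * g i = real (Suc i) * g (Suc i)" for i
    by (simp add: g_def del: of_nat_Suc)
  have IH: "matrix_pow (A + mat c) k $ z $ y = fact k * (\<Sum>i\<le>k. a i z * g (k - i))" for z
    using Suc[of z] by (simp add: a_def g_def field_simps)
  have "matrix_pow (A + mat c) (Suc k) $ x $ y
      = (\<Sum>z\<in>UNIV. A $ x $ z * matrix_pow (A + mat c) k $ z $ y)
        + c * matrix_pow (A + mat c) k $ x $ y"
  proof -
    have "(\<Sum>z\<in>UNIV. (A + mat c) $ x $ z * m z) = (\<Sum>z\<in>UNIV. A $ x $ z * m z) + c * m x"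
      for m :: "'n \<Rightarrow> real"
    proof -
      have "(\<Sum>z\<in>UNIV. (mat c :: real ^ 'n ^ 'n) $ x $ z * m z)
          = (\<Sum>z\<in>UNIV. if x = z then c * m z else 0)"
        by (intro sum.cong) (auto simp: mat_def)
      then show ?thesis by (simp add: distrib_right sum.distrib)
    qed
    then show ?thesis
      by (simp only: matrix_pow.simps matrix_matrix_mult_def vec_lambda_beta)
  qed
  also have "\<dots> = fact k * ((\<Sum>i\<le>k. (\<Sum>z\<in>UNIV. A $ x $ z * a i z) * g (k - i))
      + (\<Sum>i\<le>k. a i x * (c * g (k - i))))"
    unfolding IH sum_distrib_left sum_distrib_right distrib_left
    by (subst sum.swap) (simp add: mult_ac)
  \<comment> \<open>Multiplication by \<open>A\<close> raises the index of \<open>a\<close> with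
    weight \<open>Suc i\<close>. After reindexing, the weight \<open>i\<close> kills the new term at
    0. Likewise \<open>c\<close> raises the index of \<open>g\<close>, and the weight
    \<open>Suc k - i\<close> kills the new term at \<open>Suc k\<close>.\<close>
  also have "(\<Sum>i\<le>k. (\<Sum>z\<in>UNIV. A $ x $ z * a i z) * g (k - i))
      = (\<Sum>i\<le>Suc k. real i * (a i x * g (Suc k - i)))"
    unfolding a_Suc sum.atMost_Suc_shift by (simp add: mult_ac)
  also have "(\<Sum>i\<le>k. a i x * (c * g (k - i)))
      = (\<Sum>i\<le>Suc k. real (Suc k - i) * (a i x * g (Suc k - i)))"
    unfolding g_Suc sum.atMost_Suc by (auto simp: Suc_diff_le intro!: sum.cong)
  \<comment> \<open>The two weights add up to \<open>Suc k\<close>, which completes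
    \<open>fact k\<close> to \<open>fact (Suc k)\<close>.\<close>
  also have "(\<Sum>i\<le>Suc k. real i * (a i x * g (Suc k - i)))
        + (\<Sum>i\<le>Suc k. real (Suc k - i) * (a i x * g (Suc k - i)))
      = real (Suc k) * (\<Sum>i\<le>Suc k. a i x * g (Suc k - i))"
    unfolding sum.distrib[symmetric] sum_distrib_left
    by (intro sum.cong) (auto simp: distrib_right[symmetric] of_nat_diff)
  finally show ?case
    unfolding a_def[symmetric] g_def[symmetric] fact_Suc by (simp del: of_nat_Suc sum.atMost_Suc)
qed (simp add: mat_def)

lemma matrix_exp_add_mat:
  fixes A :: "real ^ 'n::finite ^ 'n"
  shows "matrix_exp (A + mat c) = exp c *\<^sub>R matrix_exp A"
proof -
  have "matrix_exp (A + mat c) $ x $ y = exp c * matrix_exp A $ x $ y" for x y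
  proof -
    have c: "(\<lambda>k. c ^ k / fact k) sums exp c"
      using exp_converges[of c] by (simp add: divide_inverse mult.commute)
    have "summable (\<lambda>k. \<bar>c ^ k / fact k\<bar>)"
      using summable_norm_exp[of c] by (simp add: divide_inverse mult.commute)
    then have "(\<lambda>k. \<Sum>i\<le>k. (matrix_pow A i $ x $ y / fact i) * (c ^ (k - i) / fact (k - i)))
        sums ((\<Sum>k. matrix_pow A k $ x $ y / fact k) * (\<Sum>k. c ^ k / fact k))"
      by (intro Cauchy_product_sums) (simp_all add: matrix_exp_summable_abs del: abs_divide)
    then have "(\<lambda>k. matrix_pow (A + mat c) k $ x $ y / fact k) sums (matrix_exp A $ x $ y * exp c)"
      by (simp only: matrix_pow_add_mat sums_unique[OF matrix_exp_nth_sums, symmetric]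
          sums_unique[OF c, symmetric])
    with matrix_exp_nth_sums[of "A + mat c" x y] show ?thesis
      by (auto dest: sums_unique2)
  qed
  then show ?thesis by (simp add: vec_eq_iff)
qed

section \<open>Positivity, fixed functions and invariant measures of semigroups\<close>

lemma matrix_exp_nonneg:
  assumes "\<And>x y. 0 \<le> A $ x $ y"
  shows "0 \<le> matrix_exp A $ x $ y"
proof -
  have "0 \<le> matrix_pow A k $ x $ y" for k x y
    by (induction k arbitrary: x) (auto simp: mat_def matrix_matrix_mult_def assms intro!: sum_nonneg)
  then show ?thesis
    by (intro sums_le[OF _ sums_zero matrix_exp_nth_sums]) simp
qed

text \<open>A large multiple of the identity makes every entry nonnegative, and adding it only
  multiplies the exponential by a positive scalar.\<close>

lemma matrix_exp_nonneg_of_offdiag: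
  fixes A :: "real ^ 'n::finite ^ 'n"
  assumes "\<And>x y. x \<noteq> y \<Longrightarrow> 0 \<le> A $ x $ y"
  shows "0 \<le> matrix_exp A $ x $ y"
proof -
  define c where "c = (\<Sum>x\<in>UNIV. \<bar>A $ x $ x\<bar>)"
  have "\<bar>A $ x $ x\<bar> \<le> c" for x
    unfolding c_def by (intro member_le_sum) auto
  then have "0 \<le> A $ x $ x + c" for x
    by (smt (verit))
  then have "0 \<le> (A + mat c) $ x $ y" for x y
    by (cases "x = y") (simp_all add: mat_def assms)
  then have "0 \<le> matrix_exp (A + mat c) $ x $ y"
    by (rule matrix_exp_nonneg)
  then show ?thesis
    by (simp add: matrix_exp_add_mat zero_le_mult_iff)
qed

text \<open>Only the term \<open>k = 0\<close> of the series survives. With the constant function 1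
  this is conservation of mass.\<close>

lemma matrix_exp_kernel:
  fixes A :: "real ^ 'n::finite ^ 'n"
  assumes "A *v f = 0"
  shows "matrix_exp A *v f = f"
proof -
  have "matrix_pow A k *v f = (if k = 0 then f else 0)" for k
    by (induction k) (auto simp: assms matrix_vector_mul_assoc[symmetric])
  then have *: "(\<Sum>y\<in>UNIV. matrix_pow A k $ x $ y * f $ y) = (if k = 0 then f $ x else 0)" for k x
    by (auto simp: matrix_vector_mult_def vec_eq_iff)
  have "(matrix_exp A *v f) $ x = f $ x" for x
  proof -
    have "(\<lambda>k. \<Sum>y\<in>UNIV. matrix_pow A k $ x $ y / fact k * f $ y)
        sums (\<Sum>y\<in>UNIV. matrix_exp A $ x $ y * f $ y)"
      by (intro sums_sum sums_mult2 matrix_exp_nth_sums)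
    moreover have "(\<lambda>k. \<Sum>y\<in>UNIV. matrix_pow A k $ x $ y / fact k * f $ y)
        = (\<lambda>k. if k = 0 then f $ x else 0)"
      by (simp add: fun_eq_iff sum_divide_distrib[symmetric] * )
    ultimately show ?thesis
      using sums_single[of 0 "\<lambda>_. f $ x"]
      by (auto simp: matrix_vector_mult_def dest: sums_unique2)
  qed
  then show ?thesis by (simp add: vec_eq_iff)
qed

text \<open>Each coordinate of \<open>q v* matrix_exp (t *\<^sub>R G)\<close> is an everywhere
  convergent power series in \<open>t\<close> whose linear coefficient is that coordinate of
  \<open>q v* G\<close>. Being constant for t \<ge> 0, it has derivative 0 at 0.\<close>

lemma generator_kills_of_semigroup_invariant:
  fixes G :: "real ^ 'n::finite ^ 'n"
  assumes "\<And>t. 0 \<le> t \<Longrightarrow> q v* matrix_exp (t *\<^sub>R G) = q"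
  shows "q v* G = 0"
proof -
  have "(q v* G) $ y = 0" for y
  proof -
    define c where "c k = (q v* matrix_pow G k) $ y / fact k" for k
    have "(\<lambda>k. (q v* matrix_pow (t *\<^sub>R G) k) $ y / fact k) = (\<lambda>k. c k * t ^ k)" for t
      unfolding c_def matrix_pow_scaleR
      by (simp add: fun_eq_iff vector_matrix_mult_def sum_distrib_left sum_distrib_right
          sum_divide_distrib mult_ac)
    then have sums: "(\<lambda>k. c k * t ^ k) sums ((q v* matrix_exp (t *\<^sub>R G)) $ y)" for t
      using vector_matrix_exp_nth_sums[of q "t *\<^sub>R G" y] by simp
    have "((\<lambda>t. \<Sum>k. c k * t ^ k) has_real_derivative (\<Sum>k. diffs c k * 0 ^ k)) (at 0)"
      by (intro termdiffs_strong_converges_everywhere sums_summable[OF sums])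
    \<comment> \<open>Constancy is known for nonnegative times only, so the derivatives are compared
      within \<open>{0..}\<close>; they agree there because 0 is a limit point of that set.\<close>
    then have "((\<lambda>t. \<Sum>k. c k * t ^ k) has_real_derivative c 1) (at 0 within {0..})"
      unfolding powser_zero by (simp add: diffs_def has_field_derivative_at_within)
    moreover have "((\<lambda>t. \<Sum>k. c k * t ^ k) has_real_derivative 0) (at 0 within {0..})"
    proof (rule has_field_derivative_transform_within[where f = "\<lambda>_. q $ y" and d = 1])
      show "q $ y = (\<Sum>k. c k * t ^ k)" if "t \<in> {0..}" for t
        using sums_unique[OF sums[of t]] assms[of t] that by simp
    qed auto
    moreover have "at (0::real) within {0..} \<noteq> bot"
      using trivial_limit_at_right_real[of "0::real"]
      by (simp add: at_within_Ici_at_right trivial_limit_def)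
    ultimately have "c 1 = 0"
      unfolding has_field_derivative_iff using tendsto_unique by blast
    then show ?thesis by (simp add: c_def)
  qed
  then show ?thesis by (simp add: vec_eq_iff)
qed

subsection \<open>Invariant measures of irreducible generators\<close>

text \<open>At a zero \<open>v\<close> of \<open>r\<close>, the balance equation is a vanishing sum
  of nonnegative terms, so \<open>r\<close> also vanishes wherever there is a positive rate into
  \<open>v\<close>. Zeros thus spread backwards along edges, and irreducibility leads every state to
  \<open>x0\<close>.\<close>

lemma invariant_vanishing:
  fixes G :: "real ^ 'n::finite ^ 'n"
  assumes G: "markov_generator G" "irreducible_generator G"
    and r: "\<And>x. 0 \<le> r $ x" "r v* G = 0" and x0: "r $ x0 = 0"
  shows "r = 0"
proof -
  have step: "r $ u = 0" if "r $ v = 0" "0 < G $ u $ v" for u v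
  proof (rule ccontr)
    assume "r $ u \<noteq> 0"
    then have pos: "0 < G $ u $ v * r $ u" using that r(1)[of u] by (simp add: less_le)
    have "(\<Sum>x\<in>UNIV. G $ x $ v * r $ x) = 0"
      using arg_cong[OF r(2), of "\<lambda>m. m $ v"] by (simp add: vector_matrix_mult_def mult.commute)
    moreover have "0 \<le> G $ x $ v * r $ x" for x
      using G(1) r(1)[of x] that(1) by (cases "x = v") (auto simp: markov_generator_def)
    ultimately have "G $ u $ v * r $ u = 0"
      by (simp add: sum_nonneg_eq_0_iff)
    with pos show False by simp
  qed
  have "r $ x = 0" for x
  proof -
    have "(x, x0) \<in> {(u, v). 0 < G $ u $ v}\<^sup>*"
      using G(2) by (simp add: irreducible_generator_def)
    then show ?thesis
      by (induction rule: converse_rtrancl_induct) (use x0 step in auto)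
  qed
  then show ?thesis by (simp add: vec_eq_iff)
qed

text \<open>Subtract from \<open>p\<close> the largest multiple \<open>m\<close> of \<open>q\<close>
  that keeps the difference nonnegative. The difference is invariant and vanishes where the ratio
  \<open>p / q\<close> is minimal, hence is zero; equal masses then force
  \<open>m = 1\<close>.\<close>

lemma invariant_prob_unique:
  fixes G :: "real ^ 'n::finite ^ 'n"
  assumes G: "markov_generator G" "irreducible_generator G"
    and p: "invariant_prob G p" and q: "invariant_prob G q"
  shows "p = q"
proof -
  have p0: "0 \<le> p $ x" "p v* G = 0" and p1: "(\<Sum>x\<in>UNIV. p $ x) = 1" for x
    using p by (auto simp: invariant_prob_def prob_vec_def)
  have q0: "0 \<le> q $ x" "q v* G = 0" and q1: "(\<Sum>x\<in>UNIV. q $ x) = 1" for x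
    using q by (auto simp: invariant_prob_def prob_vec_def)
  have "q \<noteq> 0" using q1 by auto
  then have qpos: "0 < q $ x" for x
    using invariant_vanishing[OF G q0, of x] q0(1)[of x] by (auto simp: less_le)
  define m where "m = Min (range (\<lambda>x. p $ x / q $ x))"
  have "m \<in> range (\<lambda>x. p $ x / q $ x)"
    unfolding m_def by (intro Min_in) auto
  then obtain x0 where x0: "m = p $ x0 / q $ x0" by auto
  have m_le: "m \<le> p $ x / q $ x" for x
    unfolding m_def by (intro Min_le) auto
  have nonneg: "0 \<le> (p - m *\<^sub>R q) $ x" for x
    using qpos[of x] m_le[of x] by (simp add: pos_le_divide_eq)
  have "(p - m *\<^sub>R q) v* G = 0"
    using p0(2) q0(2) by (simp add: vector_matrix_mult_def vec_eq_iff algebra_simps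
        sum_subtractf sum_distrib_left[symmetric])
  moreover have "(p - m *\<^sub>R q) $ x0 = 0"
    using qpos[of x0] by (simp add: x0)
  ultimately have eq: "p - m *\<^sub>R q = 0"
    using invariant_vanishing[OF G nonneg] by blast
  then have "(\<Sum>x\<in>UNIV. p $ x) = m * (\<Sum>x\<in>UNIV. q $ x)"
    by (simp add: sum_distrib_left)
  then show ?thesis using p1 q1 eq by simp
qed

subsection \<open>Reweighting\<close>

lemma prob_vec_inner_ge:
  assumes "prob_vec p" and "\<And>x. a \<le> f $ x"
  shows "a \<le> p \<bullet> f"
proof -
  have "(\<Sum>x\<in>UNIV. p $ x * a) \<le> (\<Sum>x\<in>UNIV. p $ x * f $ x)"
    using assms by (intro sum_mono mult_left_mono) (auto simp: prob_vec_def)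
  then show ?thesis
    using assms(1) by (simp add: inner_vec_def prob_vec_def sum_distrib_right[symmetric])
qed

lemma prob_vec_inner_pos:
  fixes p f :: "real ^ 'n::finite"
  assumes "prob_vec p" and "\<And>x. 0 < f $ x"
  shows "0 < p \<bullet> f"
proof -
  define a where "a = Min (range (\<lambda>x. f $ x))"
  have "a \<in> range (\<lambda>x. f $ x)" unfolding a_def by (intro Min_in) auto
  then have "0 < a" using assms(2) by auto
  also have "a \<le> p \<bullet> f"
    using assms(1) by (rule prob_vec_inner_ge) (simp add: a_def)
  finally show ?thesis .
qed

lemma prob_vec_reweight:
  assumes "prob_vec p" and "\<And>x. 0 < f $ x"
  shows "prob_vec (reweight f p)"
proof -
  have "0 < p \<bullet> f" using assms by (rule prob_vec_inner_pos)
  then show ?thesis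
    using assms
    by (auto simp: prob_vec_def reweight_def less_imp_le sum_divide_distrib[symmetric] inner_vec_def)
qed

lemma reweight_reweight_inverse:
  fixes p f :: "real ^ 'n::finite"
  assumes "prob_vec p" and f: "\<And>x. 0 < f $ x" and g: "\<And>x. g $ x = 1 / f $ x"
  shows "reweight g (reweight f p) = p"
proof -
  have pos: "0 < p \<bullet> f" using assms by (intro prob_vec_inner_pos)
  have "reweight f p \<bullet> g = (\<Sum>x\<in>UNIV. p $ x / (p \<bullet> f))"
    unfolding inner_vec_def reweight_def using f by (intro sum.cong) (auto simp: g less_imp_neq[symmetric])
  also have "\<dots> = 1 / (p \<bullet> f)"
    using assms(1) by (simp add: sum_divide_distrib[symmetric] prob_vec_def)
  finally have "reweight f p \<bullet> g = 1 / (p \<bullet> f)" .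
  then show ?thesis
    using pos f by (auto simp: reweight_def[of g] vec_eq_iff g)
      (simp add: reweight_def less_imp_neq[symmetric])
qed

lemma tv_norm_reweight_diff_le:
  fixes p q f :: "real ^ 'n::finite"
  assumes p: "prob_vec p" and q: "prob_vec q" and a: "0 < a"
    and f: "\<And>x. a \<le> f $ x" "\<And>x. f $ x \<le> b"
  shows "tv_norm (reweight f p - reweight f q) \<le> 2 * (b / a) * tv_norm (p - q)"
proof -
  define P Q where "P = p \<bullet> f" and "Q = q \<bullet> f"
  have P: "a \<le> P" and Q: "a \<le> Q"
    unfolding P_def Q_def using f p q by (auto intro: prob_vec_inner_ge)
  have fpos: "0 < f $ x" for x using a f(1)[of x] by simp
  have weighted: "(\<Sum>x\<in>UNIV. \<bar>p $ x - q $ x\<bar> * f $ x) \<le> b * tv_norm (p - q)"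
    unfolding tv_norm_def sum_distrib_left by (intro sum_mono) (simp add: f(2) mult.commute[of _ "f $ _"] mult_right_mono)
  have "\<bar>P - Q\<bar> = \<bar>\<Sum>x\<in>UNIV. (p $ x - q $ x) * f $ x\<bar>"
    unfolding P_def Q_def by (simp add: inner_vec_def sum_subtractf left_diff_distrib)
  also have "\<dots> \<le> (\<Sum>x\<in>UNIV. \<bar>p $ x - q $ x\<bar> * f $ x)"
    using fpos by (intro order_trans[OF sum_abs] sum_mono) (simp add: abs_mult less_imp_le)
  also note weighted
  finally have PQ: "\<bar>P - Q\<bar> \<le> b * tv_norm (p - q)" .
  have "\<bar>(reweight f p - reweight f q) $ x\<bar>
      \<le> (\<bar>p $ x - q $ x\<bar> * f $ x + q $ x * f $ x / Q * \<bar>P - Q\<bar>) / P" for x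
  proof -
    \<comment> \<open>The splitting separates the change of the measure from the change of the
      normalizing constant.\<close>
    have "(reweight f p - reweight f q) $ x
        = ((p $ x - q $ x) * f $ x + q $ x * f $ x / Q * (Q - P)) / P"
      using P Q a by (simp add: reweight_def P_def[symmetric] Q_def[symmetric] field_simps)
    moreover have "\<bar>(p $ x - q $ x) * f $ x + q $ x * f $ x / Q * (Q - P)\<bar>
        \<le> \<bar>p $ x - q $ x\<bar> * f $ x + q $ x * f $ x / Q * \<bar>P - Q\<bar>"
      using fpos[of x] q Q a
      by (intro order_trans[OF abs_triangle_ineq]) (auto simp: abs_mult prob_vec_def abs_minus_commute)
    ultimately show ?thesis
      using P a by (simp add: divide_right_mono)
  qed
  then have "tv_norm (reweight f p - reweight f q)
      \<le> (\<Sum>x\<in>UNIV. (\<bar>p $ x - q $ x\<bar> * f $ x + q $ x * f $ x / Q * \<bar>P - Q\<bar>) / P)"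
    unfolding tv_norm_def by (intro sum_mono)
  \<comment> \<open>The measure \<open>q f / Q\<close> has mass 1, so the second part contributes
    just the change of constants. Each part is at most \<open>b * tv_norm (p - q)\<close>, whence
    the factor 2; the denominator \<open>a\<close> bounds \<open>P\<close> from below.\<close>
  also have "\<dots> = ((\<Sum>x\<in>UNIV. \<bar>p $ x - q $ x\<bar> * f $ x) + \<bar>P - Q\<bar>) / P"
  proof -
    have "(\<Sum>x\<in>UNIV. q $ x * f $ x / Q * \<bar>P - Q\<bar>) = Q / Q * \<bar>P - Q\<bar>"
      unfolding sum_divide_distrib[symmetric] sum_distrib_right[symmetric]
      by (simp add: Q_def inner_vec_def)
    then show ?thesis
      using Q a by (simp add: sum_divide_distrib[symmetric] sum.distrib)
  qed
  also have "\<dots> \<le> (b * tv_norm (p - q) + b * tv_norm (p - q)) / a"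
    using weighted PQ P a by (intro frac_le) (auto intro: sum_nonneg simp: order_trans[OF abs_ge_zero])
  finally show ?thesis by simp
qed

text \<open>Nonnegative off-diagonal rates give positivity of the semigroup; zero row sums make the
  function 1 fixed, so total mass is kept.\<close>

lemma prob_vec_vector_matrix_exp:
  assumes G: "markov_generator G" and p: "prob_vec p" and t: "0 \<le> t"
  shows "prob_vec (p v* matrix_exp (t *\<^sub>R G))"
proof -
  have "0 \<le> matrix_exp (t *\<^sub>R G) $ x $ y" for x y
    using G t by (intro matrix_exp_nonneg_of_offdiag) (auto simp: markov_generator_def)
  then have "0 \<le> (p v* matrix_exp (t *\<^sub>R G)) $ x" for x
    using p by (auto simp: vector_matrix_mult_def prob_vec_def intro!: sum_nonneg)
  moreover have "(t *\<^sub>R G) *v 1 = 0"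
    using G by (simp add: vec_eq_iff matrix_vector_mult_def markov_generator_def
        sum_distrib_left[symmetric])
  then have "matrix_exp (t *\<^sub>R G) *v 1 = 1"
    by (rule matrix_exp_kernel)
  then have "(p v* matrix_exp (t *\<^sub>R G)) \<bullet> 1 = p \<bullet> 1"
    by (simp add: dot_lmul_matrix)
  ultimately show ?thesis
    using p by (simp add: prob_vec_def inner_vec_def)
qed

subsection \<open>Doob's transform\<close>

lemma tilde_generator_markov:
  assumes "markov_generator L" and "\<And>x. 0 < phi $ x"
  shows "markov_generator (tilde_generator L phi)"
proof -
  have "(\<Sum>y\<in>UNIV. tilde_generator L phi $ x $ y) = 0" for x
  proof -
    have "(\<Sum>y\<in>UNIV. tilde_generator L phi $ x $ y)
        = tilde_generator L phi $ x $ x + (\<Sum>y\<in>UNIV - {x}. tilde_generator L phi $ x $ y)"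
      by (intro sum.remove) auto
    also have "(\<Sum>y\<in>UNIV - {x}. tilde_generator L phi $ x $ y)
        = (\<Sum>y\<in>UNIV - {x}. L $ x $ y * (phi $ y / phi $ x))"
      by (intro sum.cong) (auto simp: tilde_generator_def)
    finally show ?thesis by (simp add: tilde_generator_def)
  qed
  then show ?thesis
    using assms by (auto simp: markov_generator_def tilde_generator_def less_imp_le)
qed

lemma tilde_generator_irreducible:
  assumes L: "irreducible_generator L" and phi: "\<And>x. 0 < phi $ x"
  shows "irreducible_generator (tilde_generator L phi)"
proof -
  have "0 < tilde_generator L phi $ u $ v" if "0 < L $ u $ v" "u \<noteq> v" for u v
    using that phi by (simp add: tilde_generator_def)
  \<comment> \<open>Tilting keeps the off-diagonal edges; pairs with \<open>u = v\<close> are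
    covered by reflexivity of the closure.\<close>
  then have "{(u, v). 0 < L $ u $ v} \<subseteq> {(u, v). 0 < tilde_generator L phi $ u $ v}\<^sup>*"
    by auto
  then have "{(u, v). 0 < L $ u $ v}\<^sup>* \<subseteq> {(u, v). 0 < tilde_generator L phi $ u $ v}\<^sup>*"
    by (rule rtrancl_subset_rtrancl)
  then show ?thesis
    using L unfolding irreducible_generator_def by blast
qed

lemma tilde_generator_similar:
  fixes L :: "real ^ 'n::finite ^ 'n"
  assumes phi: "\<And>x. 0 < phi $ x" and eig: "(L - diag_matrix V) *v phi = (- l) *s phi"
  shows "(L - diag_matrix V) $ x $ y
    = phi $ x * (tilde_generator L phi + mat (- l)) $ x $ y / phi $ y"
proof (cases "x = y")
  case False
  then show ?thesis
    using phi[of x] phi[of y] by (simp add: diag_matrix_def tilde_generator_def mat_def)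
next
  case True
  have "(\<Sum>z\<in>UNIV. (L - diag_matrix V) $ x $ z * phi $ z) = - l * phi $ x"
    using arg_cong[OF eig, of "\<lambda>f. f $ x"] by (simp add: matrix_vector_mult_def)
  also have "(\<Sum>z\<in>UNIV. (L - diag_matrix V) $ x $ z * phi $ z)
      = (L - diag_matrix V) $ x $ x * phi $ x
        + (\<Sum>z\<in>UNIV - {x}. (L - diag_matrix V) $ x $ z * phi $ z)"
    by (intro sum.remove) auto
  \<comment> \<open>Off the diagonal \<open>V\<close> does not contribute, and zero row sums of the
    tilted generator collect these terms in its diagonal entry. The eigenvalue equation thus fixes
    the diagonal of the conjugated matrix.\<close>
  also have "(\<Sum>z\<in>UNIV - {x}. (L - diag_matrix V) $ x $ z * phi $ z)
      = - phi $ x * tilde_generator L phi $ x $ x"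
    using phi[of x] unfolding tilde_generator_def
    by (auto simp: sum_distrib_left diag_matrix_def sum_negf less_imp_neq[symmetric] intro!: sum.cong)
  finally have "(L - diag_matrix V) $ x $ x * phi $ x
      = phi $ x * (tilde_generator L phi $ x $ x - l)"
    by (simp add: algebra_simps)
  then show ?thesis
    using phi[of x] True by (simp add: mat_def field_simps)
qed

lemma cond_law_eq_reweight:
  fixes L :: "real ^ 'n::finite ^ 'n"
  assumes phi: "\<And>x. 0 < phi $ x" and eig: "(L - diag_matrix V) *v phi = (- l) *s phi"
    and mu: "prob_vec mu" and g: "\<And>x. g $ x = 1 / phi $ x"
  shows "cond_law L V mu t
    = reweight g (reweight phi mu v* matrix_exp (t *\<^sub>R tilde_generator L phi))"
proof -
  define E where "E = matrix_exp (t *\<^sub>R (L - diag_matrix V))"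
  define P where "P = matrix_exp (t *\<^sub>R tilde_generator L phi)"
  define p where "p = reweight phi mu v* P"
  \<comment> \<open>The scalar combines the decay from the shift by \<open>- l\<close> with the
    normalization of \<open>reweight phi mu\<close>. It occurs in both numerator and denominator of
    the conditional law and cancels.\<close>
  define c where "c = exp (- (t * l)) * (mu \<bullet> phi)"
  have mpos: "0 < mu \<bullet> phi" using mu phi by (rule prob_vec_inner_pos)
  then have c: "c \<noteq> 0" by (simp add: c_def)
  have E: "E $ x $ y = phi $ x * (exp (- (t * l)) * P $ x $ y) / phi $ y" for x y
  proof -
    have "E $ x $ y
        = phi $ x * matrix_exp (t *\<^sub>R tilde_generator L phi + mat (- (t * l))) $ x $ y / phi $ y"
      unfolding E_def
    proof (rule matrix_exp_similar)
      show "(t *\<^sub>R (L - diag_matrix V)) $ x $ y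
          = phi $ x * (t *\<^sub>R tilde_generator L phi + mat (- (t * l))) $ x $ y / phi $ y" for x y
        using tilde_generator_similar[OF phi eig, of x y]
        by (simp add: mat_def algebra_simps)
    qed (use phi in \<open>simp add: less_imp_neq[symmetric]\<close>)
    then show ?thesis by (simp only: matrix_exp_add_mat P_def vector_scaleR_component real_scaleR_def)
  qed
  have muE: "(mu v* E) $ y = c * (p $ y * g $ y)" for y
    using mpos
    by (simp add: vector_matrix_mult_def E p_def c_def g reweight_def sum_distrib_left
        sum_divide_distrib mult_ac less_imp_neq[symmetric])
  then have "mu \<bullet> (E *v 1) = c * (p \<bullet> g)"
    by (simp add: dot_lmul_matrix[symmetric]) (simp add: inner_vec_def sum_distrib_left)
  then show ?thesis
    using c by (simp add: cond_law_def Let_def E_def[symmetric] P_def[symmetric] p_def[symmetric]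
        vec_eq_iff muE) (simp add: reweight_def)
qed

subsection \<open>Exponential rates\<close>

text \<open>A multiplicative constant costs \<open>ln C / t\<close> in the rate. If \<open>a\<close>
  is not positive the left side is -\<infinity>; otherwise \<open>b\<close> must be positive and
  both logarithms are real.\<close>

lemma ext_ln_mult_le:
  assumes "a \<le> C * b" "0 < C" "0 < t"
  shows "ereal (1 / t) * ext_ln a \<le> ereal (1 / t) * ext_ln b + ereal (ln C / t)"
proof (cases "a \<le> 0")
  case False
  then have "0 < C * b" using assms(1) by simp
  then have b: "0 < b" using assms(2) by (simp add: zero_less_mult_iff)
  have "ln a \<le> ln (C * b)" using False assms(1) by simp
  also have "\<dots> = ln b + ln C" using b assms(2) by (simp add: ln_mult)
  finally have "ln a / t \<le> (ln b + ln C) / t" using assms(3) by (simp add: divide_right_mono)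
  then show ?thesis using False b by (simp add: ext_ln_def add_divide_distrib)
qed (use assms(3) in \<open>simp add: ext_ln_def\<close>)

text \<open>The rate of \<open>a\<close> is squeezed between the rate of \<open>b\<close> plus and
  minus \<open>ln C / t\<close>, which tends to 0.\<close>

lemma exp_rate_transfer:
  fixes l :: ereal
  assumes C: "0 < C" and ab: "\<And>t. 0 \<le> t \<Longrightarrow> a t \<le> C * b t"
    and ba: "\<And>t. 0 \<le> t \<Longrightarrow> b t \<le> C * a t"
    and lim: "((\<lambda>t. ereal (1 / t) * ext_ln (b t)) \<longlongrightarrow> l) at_top"
  shows "((\<lambda>t. ereal (1 / t) * ext_ln (a t)) \<longlongrightarrow> l) at_top"
proof (rule tendsto_sandwich)
  have "((\<lambda>t. k / t) \<longlongrightarrow> 0) at_top" for k :: real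
    by (rule real_tendsto_divide_at_top[OF tendsto_const filterlim_ident])
  then have "((\<lambda>t. ereal (k / t)) \<longlongrightarrow> 0) at_top" for k :: real
    by (simp add: zero_ereal_def)
  \<comment> \<open>The added term has a finite limit, so the sum of limits is safe even for
    \<open>l\<close> infinite.\<close>
  then have "((\<lambda>t. ereal (1 / t) * ext_ln (b t) + ereal (k / t)) \<longlongrightarrow> l + 0) at_top" for k :: real
    by (intro tendsto_add_ereal_general lim) auto
  then have lim_add: "((\<lambda>t. ereal (1 / t) * ext_ln (b t) + ereal (k / t)) \<longlongrightarrow> l) at_top"
    for k :: real
    by simp
  show "\<forall>\<^sub>F t in at_top. ereal (1 / t) * ext_ln (a t)
      \<le> ereal (1 / t) * ext_ln (b t) + ereal (ln C / t)"
    using eventually_gt_at_top[of 0]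
    by eventually_elim (auto intro!: ext_ln_mult_le ab C)
  show "\<forall>\<^sub>F t in at_top. ereal (1 / t) * ext_ln (b t) + ereal (- ln C / t)
      \<le> ereal (1 / t) * ext_ln (a t)"
    using eventually_gt_at_top[of 0]
  proof eventually_elim
    case (elim t)
    have "ereal (1 / t) * ext_ln (b t) \<le> ereal (1 / t) * ext_ln (a t) + ereal (ln C / t)"
      using elim by (intro ext_ln_mult_le ba C) auto
    then show ?case
      by (cases "ereal (1 / t) * ext_ln (b t)"; cases "ereal (1 / t) * ext_ln (a t)") auto
  qed
  show "((\<lambda>t. ereal (1 / t) * ext_ln (b t) + ereal (ln C / t)) \<longlongrightarrow> l) at_top"
    and "((\<lambda>t. ereal (1 / t) * ext_ln (b t) + ereal (- ln C / t)) \<longlongrightarrow> l) at_top"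
    by (rule lim_add)+
qed

lemma same_exp_rate_of_comparable:
  assumes "0 < C" "\<And>t. 0 \<le> t \<Longrightarrow> a t \<le> C * b t" "\<And>t. 0 \<le> t \<Longrightarrow> b t \<le> C * a t"
  shows "same_exp_rate a b"
  unfolding same_exp_rate_def
proof (intro allI impI iffI)
  fix l :: ereal
  show "((\<lambda>t. ereal (1 / t) * ext_ln (b t)) \<longlongrightarrow> l) at_top"
    if "((\<lambda>t. ereal (1 / t) * ext_ln (a t)) \<longlongrightarrow> l) at_top"
    using assms that by (intro exp_rate_transfer[where a = b and b = a and C = C])
  show "((\<lambda>t. ereal (1 / t) * ext_ln (a t)) \<longlongrightarrow> l) at_top"
    if "((\<lambda>t. ereal (1 / t) * ext_ln (b t)) \<longlongrightarrow> l) at_top"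
    using assms that by (intro exp_rate_transfer[where a = a and b = b and C = C])
qed

section \<open>Two-sided comparison and equality of rates\<close>

theorem theorem1:
  fixes Lbar :: "real ^ ('n::finite option) ^ ('n option)"
    and L :: "real ^ 'n ^ 'n"
    and V eta nu phi phistar etatilde mu0 :: "real ^ 'n"
    and lambda1 :: real
  assumes "markov_generator Lbar"
    and "\<forall>y. Lbar $ None $ y = 0"
    and "V = (\<chi> x. Lbar $ Some x $ None)"
    and "(\<chi> x y. Lbar $ Some x $ Some y) = L - diag_matrix V"
    and "irreducible_generator L"
    and "quasi_stationary L V nu"
    and "principal_eigenvalue (diag_matrix V - L) lambda1"
    and "invariant_prob L eta"
    and "\<forall>x. 0 < phi $ x"
    and "(L - diag_matrix V) *v phi = (- lambda1) *s phi"
    and "eta \<bullet> (\<chi> x. (phi $ x)\<^sup>2) = 1"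
    and "\<forall>x. 0 < phistar $ x"
    and "(adjoint_generator eta L - diag_matrix V) *v phistar = (- lambda1) *s phistar"
    and "eta \<bullet> phistar = 1"
    and "invariant_prob (tilde_generator L phi) etatilde"
    and "prob_vec mu0"
  shows "(\<forall>t\<ge>0.
            min_val phi / (2 * max_val phi)
              * tv_norm (reweight phi mu0 v* matrix_exp (t *\<^sub>R tilde_generator L phi) - etatilde)
              \<le> tv_norm (cond_law L V mu0 t - nu) \<and>
            tv_norm (cond_law L V mu0 t - nu)
              \<le> 2 * (max_val phi / min_val phi)
                * tv_norm (reweight phi mu0 v* matrix_exp (t *\<^sub>R tilde_generator L phi) - etatilde))
       \<and> same_exp_rate
            (\<lambda>t. tv_norm (cond_law L V mu0 t - nu))
            (\<lambda>t. tv_norm (reweight phi mu0 v* matrix_exp (t *\<^sub>R tilde_generator L phi) - etatilde))"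
proof -
  have phi: "\<And>x. 0 < phi $ x" using assms(9) by blast
  note eig = assms(10) and mu0 = assms(16)
  have nu: "prob_vec nu" and nu_t: "\<And>t. 0 \<le> t \<Longrightarrow> cond_law L V nu t = nu"
    using assms(6) by (auto simp: quasi_stationary_def)
  define G where "G = tilde_generator L phi"
  have L: "markov_generator L"
    using markov_generator_decomposition[OF assms(1,3,4)] .
  have G: "markov_generator G" "irreducible_generator G"
    unfolding G_def using tilde_generator_markov[OF L phi] tilde_generator_irreducible[OF assms(5) phi]
    by auto
  define g :: "real ^ 'n" where "g = (\<chi> x. 1 / phi $ x)"
  have g: "g $ x = 1 / phi $ x" and gpos: "0 < g $ x" and phi_g: "phi $ x = 1 / g $ x" for x
    using phi by (simp_all add: g_def)
  define p where "p m t = reweight phi m v* matrix_exp (t *\<^sub>R G)" for m t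
  have p: "prob_vec (p m t)" if "prob_vec m" "0 \<le> t" for m t
    unfolding p_def using that by (intro prob_vec_vector_matrix_exp[OF G(1)] prob_vec_reweight phi)
  have law: "cond_law L V m t = reweight g (p m t)" if "prob_vec m" for m t
    unfolding p_def G_def using phi eig that g by (rule cond_law_eq_reweight)
  have law': "reweight phi (cond_law L V m t) = p m t" if "prob_vec m" "0 \<le> t" for m t
    unfolding law[OF that(1)] using p[OF that] gpos phi_g by (rule reweight_reweight_inverse)
  \<comment> \<open>Quasi-stationarity freezes the conditional law at \<open>nu\<close>, so the
    tilted flow started from \<open>reweight phi nu\<close> is constant.\<close>
  have "reweight phi nu v* matrix_exp (t *\<^sub>R G) = reweight phi nu" if "0 \<le> t" for t
    using law'[OF nu that] by (simp add: nu_t that p_def)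
  then have "invariant_prob G (reweight phi nu)"
    unfolding invariant_prob_def
    by (intro conjI prob_vec_reweight[OF nu phi] generator_kills_of_semigroup_invariant)
  then have etatilde: "reweight phi nu = etatilde"
    using invariant_prob_unique[OF G] assms(15) by (simp add: G_def)
  define a b where "a = min_val phi" and "b = max_val phi"
  have a_le: "a \<le> phi $ x" and le_b: "phi $ x \<le> b" for x
    by (simp_all add: a_def b_def min_val_def max_val_def)
  have "a \<in> range (\<lambda>x. phi $ x)"
    unfolding a_def min_val_def by (intro Min_in) auto
  then have a: "0 < a" using phi by auto
  then have b: "0 < b" using a_le le_b order_trans less_le_trans by metis
  have prob_law: "prob_vec (cond_law L V mu0 t)" if "0 \<le> t" for t
    unfolding law[OF mu0] using p[OF mu0 that] gpos by (rule prob_vec_reweight)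
  have lower: "tv_norm (p mu0 t - etatilde) \<le> 2 * (b / a) * tv_norm (cond_law L V mu0 t - nu)"
    if "0 \<le> t" for t
    using tv_norm_reweight_diff_le[OF prob_law[OF that] nu a a_le le_b]
    by (simp only: law'[OF mu0 that] etatilde)
  have upper: "tv_norm (cond_law L V mu0 t - nu) \<le> 2 * (b / a) * tv_norm (p mu0 t - etatilde)"
    if "0 \<le> t" for t
  proof -
    have "prob_vec etatilde" using assms(15) by (simp add: invariant_prob_def)
    \<comment> \<open>Inverting \<open>phi\<close> swaps the bounds but keeps their ratio
      \<open>b / a\<close>, so both directions have the same Lipschitz constant. It serves as the
      single constant for the rates.\<close>
    moreover have "1 / b \<le> g $ x" "g $ x \<le> 1 / a" for x
      using a_le[of x] le_b[of x] a phi[of x] by (simp_all add: g frac_le)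
    ultimately have "tv_norm (reweight g (p mu0 t) - reweight g etatilde)
        \<le> 2 * (1 / a / (1 / b)) * tv_norm (p mu0 t - etatilde)"
      using b by (intro tv_norm_reweight_diff_le p mu0 that) auto
    moreover have "reweight g etatilde = nu"
      unfolding etatilde[symmetric] using nu phi g by (rule reweight_reweight_inverse)
    ultimately show ?thesis by (simp add: law[OF mu0])
  qed
  have rate: "same_exp_rate (\<lambda>t. tv_norm (cond_law L V mu0 t - nu)) (\<lambda>t. tv_norm (p mu0 t - etatilde))"
    using a b upper lower by (intro same_exp_rate_of_comparable[of "2 * (b / a)"]) auto
  have "a / (2 * b) * tv_norm (p mu0 t - etatilde) \<le> tv_norm (cond_law L V mu0 t - nu)"
    if "0 \<le> t" for t
    using lower[OF that] a b by (simp add: field_simps)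
  with upper rate show ?thesis
    unfolding p_def G_def a_def b_def by blast
qed

end
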